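(* Let $\mathfrak{A}$ and $\mathfrak{B}$ be JB$^*$-algebras. Then every continuous surjective Jordan homomorphism $\Phi:\mathfrak{A}\to\mathfrak{B}$ extends to a Jordan homomorphism $\tilde{\Phi}:M(\mathfrak{A})\to M(\mathfrak{B})$ which is J-strict continuous, i.e. continuous from $(M(\mathfrak{A}),S(M(\mathfrak{A}),\mathfrak{A}))$ to $(M(\mathfrak{B}),S(M(\mathfrak{B}),\mathfrak{B}))$.
   Context: A JB$^*$-algebra is a complex Banach space $\mathfrak{A}$ with a commutative bilinear product $\circ$ satisfying the Jordan identity $(x\circ y)\circ x^2 = x\circ(y\circ x^2)$, with $\|a\circ b\|\le\|a\|\,\|b\|$, and with a conjugate-linear algebra involution $^*$ such that $\|U_a(a^* )\|=\|a\|^3$ for all $a$, where $U_a(b)=2(a\circ b)\circ a-a^2\circ b$. The bidual $\mathfrak{A}^{**}$ is a unital JB$^*$-algebra (a JBW$^*$-algebra) whose product and involution extend those of $\mathfrak{A}$ and whose product is separately weak$^*$ continuous. The multipliers algebra is $M(\mathfrak{A})=\{x\in\mathfrak{A}^{**}: x\circ\mathfrak{A}\subseteq\mathfrak{A}\}$, a unital JB$^*$-subalgebra of $\mathfrak{A}^{**}$ containing $\mathfrak{A}$ as a closed Jordan ideal. The J-strict topology $S(M(\mathfrak{A}),\mathfrak{A})$ is the locally convex topology on $M(\mathfrak{A})$ generated by the seminorms $\rho_a(z)=\|z\circ a\|$, $a\in\mathfrak{A}$. A Jordan homomorphism is a linear map $\Phi$ with $\Phi(x\circ y)=\Phi(x)\circ\Phi(y)$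 for all $x,y$ (it is not required to preserve the involution). *)

theory Defs
  imports "HOL-Analysis.Analysis"
begin

section \<open>Complex normed spaces\<close>

class complex_normed_vector = real_normed_vector +
  fixes scaleC :: "complex \<Rightarrow> 'a \<Rightarrow> 'a"  (infixr \<open>*\<^sub>C\<close> 75)
  assumes scaleR_scaleC: "r *\<^sub>R x = complex_of_real r *\<^sub>C x"
    and scaleC_add_right: "c *\<^sub>C (x + y) = c *\<^sub>C x + c *\<^sub>C y"
    and scaleC_add_left: "(c + d) *\<^sub>C x = c *\<^sub>C x + d *\<^sub>C x"
    and scaleC_scaleC: "c *\<^sub>C (d *\<^sub>C x) = (c * d) *\<^sub>C x"
    and norm_scaleC: "norm (c *\<^sub>C x) = cmod c * norm x"

class complex_banach = complex_normed_vector + banach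


section \<open>JB*-algebras\<close>

class jordan_product =
  fixes jprod :: "'a \<Rightarrow> 'a \<Rightarrow> 'a"  (infixl \<open>\<odot>\<close> 70)

class complex_jordan_algebra = complex_normed_vector + jordan_product +
  assumes jprod_commute: "x \<odot> y = y \<odot> x"
    and jprod_add_left: "(x + y) \<odot> z = x \<odot> z + y \<odot> z"
    and jprod_scaleC_left: "(c *\<^sub>C x) \<odot> y = c *\<^sub>C (x \<odot> y)"
    and jordan_identity: "(x \<odot> y) \<odot> (x \<odot> x) = x \<odot> (y \<odot> (x \<odot> x))"

definition (in complex_jordan_algebra) U_op :: "'a \<Rightarrow> 'a \<Rightarrow> 'a" where
  "U_op a b = 2 *\<^sub>R ((a \<odot> b) \<odot> a) - (a \<odot> a) \<odot> b"

class jb_star_algebra = complex_jordan_algebra + complex_banach +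
  fixes star :: "'a \<Rightarrow> 'a"
  assumes norm_jprod: "norm (a \<odot> b) \<le> norm a * norm b"
    and star_add: "star (a + b) = star a + star b"
    and star_scaleC: "star (c *\<^sub>C a) = cnj c *\<^sub>C star a"
    and star_star: "star (star a) = a"
    and star_jprod: "star (a \<odot> b) = star a \<odot> star b"
    and norm_U_op_star: "norm (U_op a (star a)) = norm a ^ 3"


section \<open>The dual space\<close>

typedef (overloaded) 'a cdual =
  "{f :: 'a::complex_normed_vector \<Rightarrow> complex. bounded_linear f \<and> (\<forall>c x. f (c *\<^sub>C x) = c * f x)}"
  morphisms cdual_apply Abs_cdual
  by (rule exI[of _ "\<lambda>_. 0"]) auto

setup_lifting type_definition_cdual

instantiation cdual :: (complex_normed_vector) complex_normed_vector
begin

lift_definition norm_cdual :: "'a cdual \<Rightarrow> real" is onorm .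

lift_definition minus_cdual :: "'a cdual \<Rightarrow> 'a cdual \<Rightarrow> 'a cdual" is "\<lambda>f g x. f x - g x"
  by (auto intro: bounded_linear_sub simp: algebra_simps)

lift_definition uminus_cdual :: "'a cdual \<Rightarrow> 'a cdual" is "\<lambda>f x. - f x"
  by (auto intro: bounded_linear_minus)

lift_definition zero_cdual :: "'a cdual" is "\<lambda>x. 0"
  by auto

lift_definition plus_cdual :: "'a cdual \<Rightarrow> 'a cdual \<Rightarrow> 'a cdual" is "\<lambda>f g x. f x + g x"
  by (auto intro: bounded_linear_add simp: algebra_simps)

lift_definition scaleR_cdual :: "real \<Rightarrow> 'a cdual \<Rightarrow> 'a cdual" is "\<lambda>r f x. r *\<^sub>R f x"
  by (auto intro: bounded_linear_compose bounded_linear_scaleR_right)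

lift_definition scaleC_cdual :: "complex \<Rightarrow> 'a cdual \<Rightarrow> 'a cdual" is "\<lambda>c f x. c * f x"
  by (auto intro: bounded_linear_const_mult)

definition dist_cdual :: "'a cdual \<Rightarrow> 'a cdual \<Rightarrow> real" where
  "dist_cdual f g = norm (f - g)"

definition uniformity_cdual :: "('a cdual \<times> 'a cdual) filter" where
  "uniformity_cdual = (INF e\<in>{0 <..}. principal {(x, y). dist x y < e})"

definition open_cdual :: "'a cdual set \<Rightarrow> bool" where
  "open_cdual S = (\<forall>x\<in>S. \<forall>\<^sub>F (x', y) in uniformity. x' = x \<longrightarrow> y \<in> S)"

definition sgn_cdual :: "'a cdual \<Rightarrow> 'a cdual" where
  "sgn_cdual f = inverse (norm f) *\<^sub>R f"

instance
proof
  fix c :: complex and f :: "'a cdual"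
  show "norm (c *\<^sub>C f) = cmod c * norm f"
  proof transfer
    fix c :: complex and f :: "'a \<Rightarrow> complex"
    assume "bounded_linear f \<and> (\<forall>c x. f (c *\<^sub>C x) = c * f x)"
    then show "onorm (\<lambda>x. c * f x) = cmod c * onorm f"
      using onorm_scaleR[of f "cmod c"] by (simp add: onorm_def norm_mult)
  qed
next
  fix r :: real and f :: "'a cdual"
  show "r *\<^sub>R f = complex_of_real r *\<^sub>C f"
    by transfer (simp add: scaleR_conv_of_real)
qed (unfold dist_cdual_def uniformity_cdual_def open_cdual_def sgn_cdual_def,
    (rule refl | (transfer,
      force simp: fun_eq_iff onorm_triangle onorm_scaleR onorm_eq_0 algebra_simps))+)

end

type_synonym 'a bidual = "'a cdual cdual"

lemma cdual_eqI: "(\<And>x. cdual_apply f x = cdual_apply g x) \<Longrightarrow> f = g"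
  by transfer auto

lemma bounded_linear_cdual_apply: "bounded_linear (cdual_apply f)"
  by transfer auto

lemma cdual_apply_scaleC: "cdual_apply f (c *\<^sub>C x) = c * cdual_apply f x"
  by transfer auto

lemmas cdual_apply_add = linear_add[OF bounded_linear.linear[OF bounded_linear_cdual_apply]]
lemmas cdual_apply_diff = linear_diff[OF bounded_linear.linear[OF bounded_linear_cdual_apply]]

lemma norm_cdual_apply: "norm (cdual_apply f x) \<le> norm f * norm x"
  by transfer (auto intro: onorm)

lemma norm_cdual_bound:
  "0 \<le> K \<Longrightarrow> (\<And>x. norm (cdual_apply f x) \<le> K * norm x) \<Longrightarrow> norm f \<le> K"
  by transfer (rule onorm_bound)

lemma clinear_bounded_linearI:
  fixes h :: "'a::complex_normed_vector \<Rightarrow> complex"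
  assumes "\<And>x y. h (x + y) = h x + h y" "\<And>c x. h (c *\<^sub>C x) = c * h x"
    and "\<And>x. norm (h x) \<le> norm x * K"
  shows "bounded_linear h"
  by (rule bounded_linear_intro[where K = K])
    (simp_all add: assms scaleR_scaleC scaleR_conv_of_real)

lift_definition canon :: "'a::complex_normed_vector \<Rightarrow> 'a bidual" is "\<lambda>x f. cdual_apply f x"
  subgoal for x
    by (auto intro!: clinear_bounded_linearI[where K = "norm x"] norm_cdual_apply
        simp: plus_cdual.rep_eq scaleC_cdual.rep_eq)
  done

definition weak_star_topology :: "'a::complex_normed_vector cdual topology" where
  "weak_star_topology =
    topology_generated_by {{f. cdual_apply f x \<in> V} | x V. open V}"


section \<open>The product of the bidual\<close>

text \<open>
  The product of \<open>A\<^sup>*\<^sup>*\<close> is constructed as the Arens extension of the product of \<open>A\<close>: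
  first \<open>(f \<cdot> a) b = f (a \<circ> b)\<close> for \<open>f\<close> in \<open>A\<^sup>*\<close>, then \<open>(F \<cdot> f) a = F (f \<cdot> a)\<close> for \<open>F\<close> in
  \<open>A\<^sup>*\<^sup>*\<close>, and finally \<open>(G \<circ> F) f = G (F \<cdot> f)\<close>.  By \<open>bidual_prod_unique\<close> below, no other
  bilinear and separately weak* continuous product on the bidual extends the product of \<open>A\<close>,
  so this is the product of the JBW*-algebra \<open>A\<^sup>*\<^sup>*\<close>.
\<close>

lemma jprod_add_right: "x \<odot> (y + z) = x \<odot> y + x \<odot> (z::'a::jb_star_algebra)"
  by (metis jprod_add_left jprod_commute)

lemma jprod_scaleC_right: "x \<odot> (c *\<^sub>C y) = c *\<^sub>C (x \<odot> (y::'a::jb_star_algebra))"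
  by (metis jprod_scaleC_left jprod_commute)

lift_definition dual_act :: "'a::jb_star_algebra cdual \<Rightarrow> 'a \<Rightarrow> 'a cdual" is "\<lambda>f a b. f (a \<odot> b)"
proof -
  fix f :: "'a \<Rightarrow> complex" and a :: 'a
  assume f: "bounded_linear f \<and> (\<forall>c x. f (c *\<^sub>C x) = c * f x)"
  have "norm (f (a \<odot> b)) \<le> norm b * (onorm f * norm a)" for b
  proof -
    have "norm (f (a \<odot> b)) \<le> onorm f * norm (a \<odot> b)"
      using f by (simp add: onorm)
    also have "\<dots> \<le> onorm f * (norm a * norm b)"
      using f by (intro mult_left_mono norm_jprod) (simp add: onorm_pos_le)
    finally show ?thesis by (simp add: mult_ac)
  qed
  then show "bounded_linear (\<lambda>b. f (a \<odot> b)) \<and> (\<forall>c x. f (a \<odot> c *\<^sub>C x) = c * f (a \<odot> x))"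
    using f by (auto intro!: clinear_bounded_linearI
        simp: jprod_add_right jprod_scaleC_right linear_add bounded_linear.linear)
qed

lemma dual_act_add: "dual_act f (a + b) = dual_act f a + dual_act f b"
  by (rule cdual_eqI)
    (simp add: dual_act.rep_eq plus_cdual.rep_eq jprod_add_left cdual_apply_add)

lemma dual_act_scaleC: "dual_act f (c *\<^sub>C a) = c *\<^sub>C dual_act f a"
  by (rule cdual_eqI)
    (simp add: dual_act.rep_eq scaleC_cdual.rep_eq jprod_scaleC_left cdual_apply_scaleC)

lemma dual_act_add_left: "dual_act (f + g) a = dual_act f a + dual_act g a"
  by (rule cdual_eqI) (simp add: dual_act.rep_eq plus_cdual.rep_eq)

lemma dual_act_scaleC_left: "dual_act (c *\<^sub>C f) a = c *\<^sub>C dual_act f a"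
  by (rule cdual_eqI) (simp add: dual_act.rep_eq scaleC_cdual.rep_eq)

lemma norm_dual_act: "norm (dual_act f a) \<le> norm f * norm a"
proof (rule norm_cdual_bound)
  fix b
  have "norm (cdual_apply f (a \<odot> b)) \<le> norm f * norm (a \<odot> b)"
    by (rule norm_cdual_apply)
  also have "\<dots> \<le> norm f * (norm a * norm b)"
    by (intro mult_left_mono norm_jprod) simp
  finally show "norm (cdual_apply (dual_act f a) b) \<le> norm f * norm a * norm b"
    by (simp add: dual_act.rep_eq mult_ac)
qed simp

lemma norm_bidual_dual_act:
  "norm (cdual_apply F (dual_act f a)) \<le> norm F * (norm f * norm a)"
  by (rule order_trans[OF norm_cdual_apply]) (intro mult_left_mono norm_dual_act, simp)

lift_definition bidual_act :: "'a::jb_star_algebra bidual \<Rightarrow> 'a cdual \<Rightarrow> 'a cdual"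
  is "\<lambda>F f a. cdual_apply F (dual_act f a)"
  subgoal for F f
    using norm_bidual_dual_act[of F f]
    by (auto intro!: clinear_bounded_linearI[where K = "norm F * norm f"]
        simp: dual_act_add dual_act_scaleC cdual_apply_add cdual_apply_scaleC mult_ac)
  done

lemma norm_bidual_act: "norm (bidual_act F f) \<le> norm F * norm f"
  using norm_bidual_dual_act[of F f]
  by (intro norm_cdual_bound) (auto simp: bidual_act.rep_eq mult_ac)

lemma bidual_act_add: "bidual_act F (f + g) = bidual_act F f + bidual_act F g"
  by (rule cdual_eqI)
    (simp add: bidual_act.rep_eq plus_cdual.rep_eq dual_act_add_left cdual_apply_add)

lemma bidual_act_scaleC: "bidual_act F (c *\<^sub>C f) = c *\<^sub>C bidual_act F f"
  by (rule cdual_eqI)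
    (simp add: bidual_act.rep_eq scaleC_cdual.rep_eq dual_act_scaleC_left cdual_apply_scaleC)

lift_definition bidual_prod :: "'a::jb_star_algebra bidual \<Rightarrow> 'a bidual \<Rightarrow> 'a bidual"
  is "\<lambda>G F f. cdual_apply G (bidual_act F f)"
  subgoal for G F
  proof -
    have "norm (cdual_apply G (bidual_act F f)) \<le> norm f * (norm G * norm F)" for f
    proof -
      have "norm (cdual_apply G (bidual_act F f)) \<le> norm G * (norm F * norm f)"
        by (rule order_trans[OF norm_cdual_apply]) (intro mult_left_mono norm_bidual_act, simp)
      then show ?thesis by (simp add: mult_ac)
    qed
    then show ?thesis
      by (auto intro!: clinear_bounded_linearI
          simp: bidual_act_add bidual_act_scaleC cdual_apply_add cdual_apply_scaleC)
  qed
  done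

lemma bidual_prod_canon: "bidual_prod (canon a) (canon b) = canon (a \<odot> b)"
  by (rule cdual_eqI)
    (simp add: bidual_prod.rep_eq canon.rep_eq bidual_act.rep_eq dual_act.rep_eq)

lemma weak_star_nbhd:
  assumes "openin weak_star_topology U" "F \<in> U"
  shows "\<exists>T e. finite T \<and> e > 0 \<and>
    (\<forall>G. (\<forall>f\<in>T. norm (cdual_apply G f - cdual_apply F f) < e) \<longrightarrow> G \<in> U)"
proof -
  have "generate_topology_on {{f. cdual_apply f x \<in> V} | x V. open V} U"
    using assms(1) by (simp add: weak_star_topology_def openin_topology_generated_by)
  then show ?thesis using assms(2)
  proof induction
    case (Int U V)
    then obtain T e T' e' where
      "finite T" "e > 0" "\<forall>G. (\<forall>f\<in>T. norm (cdual_apply G f - cdual_apply F f) < e) \<longrightarrow> G \<in> U"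
      "finite T'" "e' > 0" "\<forall>G. (\<forall>f\<in>T'. norm (cdual_apply G f - cdual_apply F f) < e') \<longrightarrow> G \<in> V"
      by auto
    then show ?case by (intro exI[of _ "T \<union> T'"] exI[of _ "min e e'"]) auto
  next
    case (UN K)
    then obtain k where "k \<in> K" "F \<in> k" by auto
    with UN.IH[of k] show ?case by (meson UnionI)
  next
    case (Basis s)
    then obtain x V where s: "s = {f. cdual_apply f x \<in> V}" "open V" by auto
    with Basis obtain e where "e > 0" "\<forall>y. dist y (cdual_apply F x) < e \<longrightarrow> y \<in> V"
      by (metis mem_Collect_eq open_dist)
    then show ?case by (intro exI[of _ "{x}"] exI[of _ e]) (auto simp: s dist_norm)
  qed auto
qed

lemma functional_vanishing_on_finite:
  fixes L :: "'a::complex_normed_vector cdual \<Rightarrow> complex"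
  assumes "finite T"
    and "\<And>F G. L (F + G) = L F + L G" "\<And>c F. L (c *\<^sub>C F) = c * L F"
    and "\<And>F. (\<forall>f\<in>T. cdual_apply F f = 0) \<Longrightarrow> L F = 0"
  shows "\<exists>g. \<forall>F. L F = cdual_apply F g"
  using assms
proof (induction T arbitrary: L rule: finite_induct)
  case empty
  then have "\<forall>F. L F = cdual_apply F 0"
    using cdual_apply_scaleC[of _ 0 0]
    by (simp add: linear_0 bounded_linear.linear[OF bounded_linear_cdual_apply])
  then show ?case ..
next
  case (insert f T)
  show ?case
  proof (cases "\<exists>F. (\<forall>h\<in>T. cdual_apply F h = 0) \<and> cdual_apply F f \<noteq> 0")
    case False
    with insert show ?thesis by (intro insert.IH) auto
  next
    case True
    then obtain F1 where F1: "\<forall>h\<in>T. cdual_apply F1 h = 0" "cdual_apply F1 f \<noteq> 0" by auto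
    define F0 where "F0 = inverse (cdual_apply F1 f) *\<^sub>C F1"
    have F0: "\<forall>h\<in>T. cdual_apply F0 h = 0" "cdual_apply F0 f = 1"
      using F1 by (auto simp: F0_def scaleC_cdual.rep_eq)
    define L' where "L' F = L F - cdual_apply F f * L F0" for F
    have "\<exists>g. \<forall>F. L' F = cdual_apply F g"
    proof (rule insert.IH)
      fix F G c
      show "L' (F + G) = L' F + L' G" "L' (c *\<^sub>C F) = c * L' F"
        by (simp_all add: L'_def insert.prems plus_cdual.rep_eq scaleC_cdual.rep_eq algebra_simps)
      assume F: "\<forall>f\<in>T. cdual_apply F f = 0"
      have "L (F + (- cdual_apply F f) *\<^sub>C F0) = 0"
        using F F0 by (intro insert.prems(3)) (auto simp: plus_cdual.rep_eq scaleC_cdual.rep_eq)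
      then show "L' F = 0" by (simp only: L'_def insert.prems) simp
    qed
    then obtain g where g: "\<And>F. L' F = cdual_apply F g" by auto
    have "L F = cdual_apply F (g + L F0 *\<^sub>C f)" for F
      unfolding cdual_apply_add cdual_apply_scaleC g[symmetric] L'_def by simp
    then show ?thesis by blast
  qed
qed

lemma weak_star_continuous_functional:
  fixes L :: "'a::complex_normed_vector cdual \<Rightarrow> complex"
  assumes add: "\<And>F G. L (F + G) = L F + L G" and scale: "\<And>c F. L (c *\<^sub>C F) = c * L F"
    and cont: "continuous_map weak_star_topology euclidean L"
  shows "\<exists>g. \<forall>F. L F = cdual_apply F g"
proof -
  have L0: "L 0 = 0" using add[of 0 0] by simp
  have top: "topspace weak_star_topology = (UNIV :: 'a cdual set)"
    unfolding weak_star_topology_def topology_generated_by_topspace by auto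
  have "openin weak_star_topology {F. L F \<in> ball 0 1}"
    using openin_continuous_map_preimage[OF cont, of "ball 0 1"] by (simp add: top)
  from weak_star_nbhd[OF this, of 0] obtain T e where T: "finite T" "e > 0"
    "\<And>G. (\<forall>f\<in>T. norm (cdual_apply G f) < e) \<Longrightarrow> norm (L G) < 1"
    by (auto simp: L0 zero_cdual.rep_eq)
  have "L F = 0" if F: "\<forall>f\<in>T. cdual_apply F f = 0" for F
  proof (rule ccontr)
    assume "L F \<noteq> 0"
    moreover have "norm (L (inverse (L F) *\<^sub>C F)) < 1"
      using F T(2) by (intro T(3)) (auto simp: scaleC_cdual.rep_eq)
    ultimately show False by (simp add: scale)
  qed
  then show ?thesis by (intro functional_vanishing_on_finite[OF T(1) add scale]) auto
qed

theorem bidual_prod_unique: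
  fixes P :: "'a::jb_star_algebra bidual \<Rightarrow> 'a bidual \<Rightarrow> 'a bidual"
  assumes add_left: "\<And>F F' G. P (F + F') G = P F G + P F' G"
    and add_right: "\<And>F G G'. P F (G + G') = P F G + P F G'"
    and scale_left: "\<And>c F G. P (c *\<^sub>C F) G = c *\<^sub>C P F G"
    and scale_right: "\<And>c F G. P F (c *\<^sub>C G) = c *\<^sub>C P F G"
    and extends: "\<And>a b. P (canon a) (canon b) = canon (a \<odot> b)"
    and cont_left: "\<And>G. continuous_map weak_star_topology weak_star_topology (\<lambda>F. P F G)"
    and cont_right: "\<And>F. continuous_map weak_star_topology weak_star_topology (P F)"
  shows "P = bidual_prod"
proof -
  have eval: "continuous_map weak_star_topology euclidean (\<lambda>F. cdual_apply F f)"
    for f :: "'a cdual"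
    unfolding continuous_map_alt
  proof (intro conjI allI impI)
    fix V :: "complex set" assume "openin euclidean V"
    moreover have "topspace weak_star_topology = (UNIV :: 'a bidual set)"
      unfolding weak_star_topology_def topology_generated_by_topspace by auto
    ultimately show "openin weak_star_topology
        ((\<lambda>F. cdual_apply F f) -` V \<inter> topspace weak_star_topology)"
      unfolding weak_star_topology_def
      by (auto intro!: topology_generated_by_Basis)
  qed auto
  have canon_left: "cdual_apply (P (canon a) F) f = cdual_apply F (dual_act f a)" for a F f
  proof -
    have "\<exists>g. \<forall>F. cdual_apply (P (canon a) F) f = cdual_apply F g"
      using continuous_map_compose[OF cont_right eval]
      by (intro weak_star_continuous_functional)
        (simp_all add: add_right scale_right plus_cdual.rep_eq scaleC_cdual.rep_eq o_def)
    then obtain g where g: "\<And>F. cdual_apply (P (canon a) F) f = cdual_apply F g" by auto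
    have "g = dual_act f a"
    proof (rule cdual_eqI)
      fix b
      show "cdual_apply g b = cdual_apply (dual_act f a) b"
        using g[of "canon b"] by (simp add: extends canon.rep_eq dual_act.rep_eq)
    qed
    with g show ?thesis by simp
  qed
  have "cdual_apply (P G F) f = cdual_apply (bidual_prod G F) f" for G F f
  proof -
    have "\<exists>g. \<forall>G. cdual_apply (P G F) f = cdual_apply G g"
      using continuous_map_compose[OF cont_left eval]
      by (intro weak_star_continuous_functional)
        (simp_all add: add_left scale_left plus_cdual.rep_eq scaleC_cdual.rep_eq o_def)
    then obtain g where g: "\<And>G. cdual_apply (P G F) f = cdual_apply G g" by auto
    have "g = bidual_act F f"
    proof (rule cdual_eqI)
      fix a
      show "cdual_apply g a = cdual_apply (bidual_act F f) a"
        using g[of "canon a"] by (simp add: canon_left canon.rep_eq bidual_act.rep_eq)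
    qed
    with g show ?thesis by (simp add: bidual_prod.rep_eq)
  qed
  then show ?thesis by (intro ext cdual_eqI)
qed


section \<open>Multipliers and the J-strict topology\<close>

definition multipliers :: "'a::jb_star_algebra bidual set" where
  "multipliers = {x. \<forall>a. bidual_prod x (canon a) \<in> range canon}"

definition seminorm_topology ::
    "'v::ab_group_add set \<Rightarrow> ('i \<Rightarrow> 'v \<Rightarrow> real) \<Rightarrow> 'v topology" where
  "seminorm_topology M \<rho> =
    topology_generated_by {{z \<in> M. \<rho> i (z - w) < e} | i w e. w \<in> M \<and> e > 0}"

definition J_strict_topology :: "'a::jb_star_algebra bidual topology" where
  "J_strict_topology = seminorm_topology multipliers (\<lambda>a z. norm (bidual_prod z (canon a)))"

lemma canon_in_multipliers: "canon a \<in> multipliers"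
  by (auto simp: multipliers_def bidual_prod_canon)

lemma topspace_J_strict_topology:
  "topspace J_strict_topology = (multipliers :: 'a::jb_star_algebra bidual set)"
proof -
  have "z \<in> topspace J_strict_topology" if z: "z \<in> multipliers" for z :: "'a bidual"
  proof -
    let ?V = "{y \<in> multipliers. norm (bidual_prod (y - z) (canon 0)) < 1}"
    have "bidual_prod (z - z) (canon 0) = 0"
      by (rule cdual_eqI) (simp add: bidual_prod.rep_eq zero_cdual.rep_eq)
    then have "z \<in> ?V" using z by simp
    moreover have "openin J_strict_topology ?V"
      unfolding J_strict_topology_def seminorm_topology_def
      by (rule topology_generated_by_Basis) (use z zero_less_one in blast)
    ultimately show ?thesis by (meson openin_subset subsetD)
  qed
  moreover have "topspace J_strict_topology \<subseteq> (multipliers :: 'a bidual set)"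
    unfolding J_strict_topology_def seminorm_topology_def topology_generated_by_topspace by auto
  ultimately show ?thesis by blast
qed


section \<open>Jordan homomorphisms\<close>

text \<open>
  A Jordan homomorphism defined on a complex subspace \<open>S\<close> that is closed under the product \<open>p\<close>.
  The involution need not be preserved.
\<close>

definition jordan_hom_on ::
    "'v::complex_normed_vector set \<Rightarrow> ('v \<Rightarrow> 'v \<Rightarrow> 'v) \<Rightarrow>
     ('w::complex_normed_vector \<Rightarrow> 'w \<Rightarrow> 'w) \<Rightarrow> ('v \<Rightarrow> 'w) \<Rightarrow> bool" where
  "jordan_hom_on S p q \<Phi> \<longleftrightarrow>
    (\<forall>x\<in>S. \<forall>y\<in>S. \<Phi> (x + y) = \<Phi> x + \<Phi> y) \<and>
    (\<forall>c. \<forall>x\<in>S. \<Phi> (c *\<^sub>C x) = c *\<^sub>C \<Phi> x) \<and>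
    (\<forall>x\<in>S. \<forall>y\<in>S. \<Phi> (p x y) = q (\<Phi> x) (\<Phi> y))"

end

theory Submission
  imports Defs
begin

text \<open>
  The extension is the second adjoint of \<open>\<Phi>\<close>, restricted to the multipliers.

  A continuous linear map is bounded, so \<open>\<Phi>\<close> has adjoints \<open>\<Phi>\<^sup>* : B\<^sup>* \<rightarrow> A\<^sup>*\<close> and
  \<open>\<Phi>\<^sup>*\<^sup>* : A\<^sup>*\<^sup>* \<rightarrow> B\<^sup>*\<^sup>*\<close>.  The Arens product is assembled from two actions on the dual, and each
  of these is carried over by \<open>\<Phi>\<^sup>*\<close> (\<open>dual_act_adjoint\<close>, \<open>bidual_act_adjoint\<close>); therefore \<open>\<Phi>\<^sup>*\<^sup>*\<close>
  is multiplicative on the whole bidual (\<open>biadjoint_bidual_prod\<close>).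

  Surjectivity says that every element of \<open>B\<close> is some \<open>\<Phi> a\<close>, and
  \<open>\<Phi>\<^sup>*\<^sup>* z \<circ> \<Phi> a = \<Phi>\<^sup>*\<^sup>* (z \<circ> a)\<close>.  This one identity gives the remaining two claims.
  If \<open>z\<close> is a multiplier, then \<open>z \<circ> a\<close> lies in \<open>A\<close> and the right-hand side lies in \<open>B\<close>, so
  \<open>\<Phi>\<^sup>*\<^sup>* z\<close> is a multiplier.  Taking norms, each defining seminorm on \<open>M(B)\<close>, composed with
  \<open>\<Phi>\<^sup>*\<^sup>*\<close>, is at most a constant times one defining seminorm on \<open>M(A)\<close>, and this is J-strict
  continuity (\<open>continuous_map_seminorm_topology\<close>).
\<close>


section \<open>Adjoints of bounded complex linear maps\<close>

definition bounded_clinear ::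
    "('a::complex_normed_vector \<Rightarrow> 'b::complex_normed_vector) \<Rightarrow> bool" where
  "bounded_clinear T \<longleftrightarrow> bounded_linear T \<and> (\<forall>c x. T (c *\<^sub>C x) = c *\<^sub>C T x)"

lemma bounded_clinear_add: "bounded_clinear T \<Longrightarrow> T (x + y) = T x + T y"
  by (simp add: bounded_clinear_def bounded_linear.linear linear_add)

lemma bounded_clinear_diff: "bounded_clinear T \<Longrightarrow> T (x - y) = T x - T y"
  by (simp add: bounded_clinear_def bounded_linear.linear linear_diff)

lemma bounded_clinear_scaleC: "bounded_clinear T \<Longrightarrow> T (c *\<^sub>C x) = c *\<^sub>C T x"
  by (simp add: bounded_clinear_def)

lemma bounded_clinear_bound:
  assumes "bounded_clinear T"
  obtains K where "K \<ge> 0" "\<And>x. norm (T x) \<le> K * norm x"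
  using assms bounded_linear.nonneg_bounded[of T]
  by (auto simp: bounded_clinear_def mult.commute)

lemma continuous_linear_imp_bounded_linear:
  fixes T :: "'a::real_normed_vector \<Rightarrow> 'b::real_normed_vector"
  assumes "linear T" and "isCont T 0"
  shows "bounded_linear T"
proof -
  interpret linear T by fact
  obtain d where d: "d > 0" "\<And>x. norm x < d \<Longrightarrow> norm (T x) < 1"
    using assms(2) zero_less_one unfolding continuous_at_eps_delta
    by (metis dist_0_norm dist_commute zero)
  have "norm (T x) \<le> norm x * (2 / d)" for x
  proof (cases "x = 0")
    case False
    \<comment> \<open>Shrink \<open>x\<close> to length \<open>d / 2\<close>, where the image has norm below \<open>1\<close>.\<close>
    define r where "r = d / 2 / norm x"
    have "r > 0" using d(1) False by (simp add: r_def)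
    have "norm (r *\<^sub>R x) < d" using d(1) False by (simp add: r_def)
    then have "norm (T (r *\<^sub>R x)) < 1" by (rule d(2))
    then have "r * norm (T x) < 1" using \<open>r > 0\<close> by (simp add: scale)
    then have "norm (T x) < 1 / r" using \<open>r > 0\<close> by (simp add: field_simps)
    then show ?thesis by (simp add: r_def mult.commute)
  qed (simp add: zero)
  then show ?thesis by (intro bounded_linear_intro add scale)
qed

text \<open>
  The formula denotes a functional only when \<open>T\<close> is bounded and complex linear; for other \<open>T\<close> the
  value is unspecified.
\<close>

definition adjoint_map ::
    "('a::complex_normed_vector \<Rightarrow> 'b::complex_normed_vector) \<Rightarrow> 'b cdual \<Rightarrow> 'a cdual" where
  "adjoint_map T f = Abs_cdual (\<lambda>x. cdual_apply f (T x))"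

lemma cdual_apply_adjoint_map:
  assumes "bounded_clinear T"
  shows "cdual_apply (adjoint_map T f) x = cdual_apply f (T x)"
  using assms unfolding adjoint_map_def bounded_clinear_def
  by (subst Abs_cdual_inverse)
    (auto intro: bounded_linear_compose bounded_linear_cdual_apply simp: cdual_apply_scaleC)

lemma bounded_clinear_adjoint_map:
  assumes T: "bounded_clinear T"
  shows "bounded_clinear (adjoint_map T)"
proof -
  obtain K where K: "K \<ge> 0" "\<And>x. norm (T x) \<le> K * norm x"
    using bounded_clinear_bound[OF T] by blast
  have add: "adjoint_map T (f + g) = adjoint_map T f + adjoint_map T g" for f g
    by (rule cdual_eqI) (simp add: cdual_apply_adjoint_map[OF T] plus_cdual.rep_eq)
  have scale: "adjoint_map T (c *\<^sub>C f) = c *\<^sub>C adjoint_map T f" for c f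
    by (rule cdual_eqI) (simp add: cdual_apply_adjoint_map[OF T] scaleC_cdual.rep_eq)
  have "norm (adjoint_map T f) \<le> norm f * K" for f
  proof (rule norm_cdual_bound)
    fix x
    have "norm (cdual_apply f (T x)) \<le> norm f * norm (T x)"
      by (rule norm_cdual_apply)
    also have "\<dots> \<le> norm f * (K * norm x)"
      by (intro mult_left_mono K) simp
    finally show "norm (cdual_apply (adjoint_map T f) x) \<le> norm f * K * norm x"
      by (simp add: cdual_apply_adjoint_map[OF T] mult.assoc)
  qed (simp add: K)
  then have "bounded_linear (adjoint_map T)"
    by (intro bounded_linear_intro add) (simp_all add: scaleR_scaleC scale)
  then show ?thesis by (simp add: bounded_clinear_def scale)
qed

abbreviation biadjoint_map ::
    "('a::complex_normed_vector \<Rightarrow> 'b::complex_normed_vector) \<Rightarrow> 'a bidual \<Rightarrow> 'b bidual" where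
  "biadjoint_map T \<equiv> adjoint_map (adjoint_map T)"

lemma biadjoint_map_canon:
  assumes "bounded_clinear T"
  shows "biadjoint_map T (canon a) = canon (T a)"
  by (rule cdual_eqI)
    (simp add: assms cdual_apply_adjoint_map bounded_clinear_adjoint_map canon.rep_eq)


section \<open>The second adjoint of a Jordan homomorphism\<close>

context
  fixes T :: "'a::jb_star_algebra \<Rightarrow> 'b::jb_star_algebra"
  assumes T: "bounded_clinear T"
    and mult: "\<And>x y. T (x \<odot> y) = T x \<odot> T y"
begin

lemma dual_act_adjoint: "dual_act (adjoint_map T f) a = adjoint_map T (dual_act f (T a))"
  by (rule cdual_eqI) (simp add: dual_act.rep_eq cdual_apply_adjoint_map[OF T] mult)

lemma bidual_act_adjoint:
  "bidual_act F (adjoint_map T f) = adjoint_map T (bidual_act (biadjoint_map T F) f)"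
  by (rule cdual_eqI)
    (simp add: bidual_act.rep_eq dual_act_adjoint cdual_apply_adjoint_map[OF T]
      cdual_apply_adjoint_map[OF bounded_clinear_adjoint_map[OF T]])

text \<open>
  \<open>(G \<circ> F)(f) = G (F \<cdot> f)\<close>, and \<open>T\<^sup>*\<close> intertwines the action of \<open>T\<^sup>*\<^sup>* F\<close> on the dual of the target
  with that of \<open>F\<close> on the dual of the source.
\<close>

lemma biadjoint_bidual_prod:
  "biadjoint_map T (bidual_prod G F) = bidual_prod (biadjoint_map T G) (biadjoint_map T F)"
  by (rule cdual_eqI)
    (simp add: bidual_prod.rep_eq bidual_act_adjoint
      cdual_apply_adjoint_map[OF bounded_clinear_adjoint_map[OF T]])

lemma biadjoint_bidual_prod_canon:
  "bidual_prod (biadjoint_map T z) (canon (T a)) = biadjoint_map T (bidual_prod z (canon a))"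
  by (simp add: biadjoint_bidual_prod biadjoint_map_canon[OF T])

text \<open>
  Since \<open>T\<^sup>*\<^sup>* z \<circ> T a = T\<^sup>*\<^sup>* (z \<circ> a)\<close> and \<open>z \<circ> a\<close> is again an element of the algebra, \<open>T\<^sup>*\<^sup>* z\<close>
  multiplies the range of \<open>T\<close> into the range of \<open>T\<close>.  Surjectivity makes this a statement about
  all elements.
\<close>

lemma biadjoint_multipliers:
  assumes "surj T" and z: "z \<in> multipliers"
  shows "biadjoint_map T z \<in> multipliers"
  unfolding multipliers_def
proof (intro CollectI allI)
  fix b
  obtain a where b: "b = T a" using \<open>surj T\<close> by (metis surjD)
  obtain c where "bidual_prod z (canon a) = canon c"
    using z by (auto simp: multipliers_def)
  then have "bidual_prod (biadjoint_map T z) (canon b) = canon (T c)"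
    by (simp add: b biadjoint_bidual_prod_canon biadjoint_map_canon[OF T])
  then show "bidual_prod (biadjoint_map T z) (canon b) \<in> range canon" by simp
qed

end


section \<open>Continuity for seminorm topologies\<close>

lemma topspace_seminorm_topology:
  fixes \<rho> :: "'i \<Rightarrow> 'v::ab_group_add \<Rightarrow> real"
  assumes zero: "\<And>i. \<rho> i 0 = 0"
  shows "topspace (seminorm_topology M \<rho>) = M"
proof -
  have "z \<in> topspace (seminorm_topology M \<rho>)" if z: "z \<in> M" for z
  proof -
    let ?V = "{y \<in> M. \<rho> undefined (y - z) < 1}"
    have "openin (seminorm_topology M \<rho>) ?V"
      unfolding seminorm_topology_def
      by (rule topology_generated_by_Basis) (use z zero_less_one in blast)
    moreover have "z \<in> ?V" using z by (simp add: zero)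
    ultimately show ?thesis by (meson openin_subset subsetD)
  qed
  moreover have "topspace (seminorm_topology M \<rho>) \<subseteq> M"
    unfolding seminorm_topology_def topology_generated_by_topspace by auto
  ultimately show ?thesis by blast
qed

text \<open>
  The usual criterion for linear maps between locally convex spaces.  The generating sets of
  the target are seminorm balls with arbitrary centres; by the triangle inequality, around each
  point of the preimage of such a ball there is a seminorm ball of the source inside the preimage.
\<close>

lemma continuous_map_seminorm_topology:
  fixes \<rho> :: "'i \<Rightarrow> 'v::ab_group_add \<Rightarrow> real" and \<sigma> :: "'j \<Rightarrow> 'w::ab_group_add \<Rightarrow> real"
  assumes zero: "\<And>i. \<rho> i 0 = 0" "\<And>j. \<sigma> j 0 = 0"
    and triangle: "\<And>j x y. \<sigma> j (x + y) \<le> \<sigma> j x + \<sigma> j y"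
    and maps: "\<And>z. z \<in> M \<Longrightarrow> T z \<in> N"
    and bound: "\<And>j. \<exists>i K. K > 0 \<and> (\<forall>z\<in>M. \<forall>w\<in>M. \<sigma> j (T z - T w) \<le> K * \<rho> i (z - w))"
  shows "continuous_map (seminorm_topology M \<rho>) (seminorm_topology N \<sigma>) T"
proof -
  have "openin (seminorm_topology M \<rho>) (T -` U \<inter> M)"
    if "U \<in> {{z \<in> N. \<sigma> j (z - w) < e} | j w e. w \<in> N \<and> e > 0}" for U
  proof -
    obtain j w e where U: "U = {z \<in> N. \<sigma> j (z - w) < e}" using \<open>U \<in> _\<close> by blast
    obtain i K where K: "K > 0"
      "\<And>z y. z \<in> M \<Longrightarrow> y \<in> M \<Longrightarrow> \<sigma> j (T z - T y) \<le> K * \<rho> i (z - y)"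
      using bound[of j] by blast
    show ?thesis
    proof (subst openin_subopen, intro ballI)
      fix y assume y: "y \<in> T -` U \<inter> M"
      define d where "d = (e - \<sigma> j (T y - w)) / K"
      let ?V = "{z \<in> M. \<rho> i (z - y) < d}"
      have "d > 0" using y \<open>K > 0\<close> by (simp add: d_def U)
      then have "openin (seminorm_topology M \<rho>) ?V"
        using y unfolding seminorm_topology_def by (intro topology_generated_by_Basis) blast
      moreover have "y \<in> ?V" using y \<open>d > 0\<close> by (simp add: zero)
      moreover have "?V \<subseteq> T -` U \<inter> M"
      proof
        fix z assume z: "z \<in> ?V"
        have "\<sigma> j (T z - w) \<le> \<sigma> j (T z - T y) + \<sigma> j (T y - w)"
          using triangle[of j "T z - T y" "T y - w"] by simp
        also have "\<sigma> j (T z - T y) \<le> K * \<rho> i (z - y)" using y z by (intro K) auto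
        also have "K * \<rho> i (z - y) < e - \<sigma> j (T y - w)"
          using z \<open>K > 0\<close> by (simp add: d_def pos_less_divide_eq mult.commute)
        finally have "\<sigma> j (T z - w) < e" by simp
        then show "z \<in> T -` U \<inter> M" using z maps by (simp add: U)
      qed
      ultimately show "\<exists>V. openin (seminorm_topology M \<rho>) V \<and> y \<in> V \<and> V \<subseteq> T -` U \<inter> M"
        by blast
    qed
  qed
  moreover have "T ` M \<subseteq> \<Union> {{z \<in> N. \<sigma> j (z - w) < e} | j w e. w \<in> N \<and> e > 0}"
    using maps topspace_seminorm_topology[where \<rho> = \<sigma> and M = N, OF zero(2)]
    unfolding seminorm_topology_def topology_generated_by_topspace by auto
  ultimately show ?thesis
    unfolding seminorm_topology_def[of N]
    by (intro continuous_on_generated_topo) (simp_all add: topspace_seminorm_topology[where \<rho> = \<rho>, OF zero(1)])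
qed


section \<open>Extension to the multipliers\<close>

lemma bidual_prod_add_left: "bidual_prod (F + G) H = bidual_prod F H + bidual_prod G H"
  by (rule cdual_eqI) (simp add: bidual_prod.rep_eq plus_cdual.rep_eq)

lemma bidual_prod_zero_left: "bidual_prod 0 H = 0"
  using bidual_prod_add_left[of 0 0 H] by simp

lemma continuous_map_J_strict_biadjoint:
  fixes T :: "'a::jb_star_algebra \<Rightarrow> 'b::jb_star_algebra"
  assumes T: "bounded_clinear T" and mult: "\<And>x y. T (x \<odot> y) = T x \<odot> T y" and "surj T"
  shows "continuous_map J_strict_topology J_strict_topology (biadjoint_map T)"
  unfolding J_strict_topology_def
proof (rule continuous_map_seminorm_topology)
  let ?S = "biadjoint_map T"
  have S: "bounded_clinear ?S" by (intro bounded_clinear_adjoint_map T)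
  fix b
  obtain a where b: "b = T a" using \<open>surj T\<close> by (metis surjD)
  obtain K where K: "K > 0" "\<And>F. norm (?S F) \<le> norm F * K"
    using S bounded_linear.pos_bounded[of ?S] unfolding bounded_clinear_def by blast
  have "norm (bidual_prod (?S z - ?S w) (canon b)) \<le> K * norm (bidual_prod (z - w) (canon a))"
    for z w
    using K(2)[of "bidual_prod (z - w) (canon a)"]
    by (simp add: b biadjoint_bidual_prod_canon[OF T mult] mult.commute
        flip: bounded_clinear_diff[OF S])
  then show "\<exists>a K. K > 0 \<and> (\<forall>z\<in>multipliers. \<forall>w\<in>multipliers.
      norm (bidual_prod (?S z - ?S w) (canon b)) \<le> K * norm (bidual_prod (z - w) (canon a)))"
    using \<open>K > 0\<close> by blast
next
  fix z :: "'a bidual"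
  assume "z \<in> multipliers"
  then show "biadjoint_map T z \<in> multipliers"
    by (rule biadjoint_multipliers[OF T mult \<open>surj T\<close>])
qed (simp_all add: bidual_prod_zero_left bidual_prod_add_left norm_triangle_ineq)

theorem proposition2p4:
  fixes \<Phi> :: "'a::jb_star_algebra \<Rightarrow> 'b::jb_star_algebra"
  assumes "jordan_hom_on UNIV (\<odot>) (\<odot>) \<Phi>"
    and "continuous_on UNIV \<Phi>"
    and "surj \<Phi>"
  shows "\<exists>\<Psi> :: 'a bidual \<Rightarrow> 'b bidual.
    \<Psi> ` multipliers \<subseteq> multipliers \<and>
    jordan_hom_on multipliers bidual_prod bidual_prod \<Psi> \<and>
    (\<forall>a. \<Psi> (canon a) = canon (\<Phi> a)) \<and>
    continuous_map J_strict_topology J_strict_topology \<Psi>"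
proof -
  have mult: "\<Phi> (x \<odot> y) = \<Phi> x \<odot> \<Phi> y" and add: "\<Phi> (x + y) = \<Phi> x + \<Phi> y"
    and scale: "\<Phi> (c *\<^sub>C x) = c *\<^sub>C \<Phi> x" for x y c
    using assms(1) by (simp_all add: jordan_hom_on_def)
  have "linear \<Phi>" by (rule linearI) (simp_all add: add scale scaleR_scaleC)
  moreover have "isCont \<Phi> 0"
    using assms(2) by (simp add: continuous_on_eq_continuous_at)
  ultimately have \<Phi>: "bounded_clinear \<Phi>"
    by (simp add: bounded_clinear_def continuous_linear_imp_bounded_linear scale)
  have \<Psi>: "bounded_clinear (biadjoint_map \<Phi>)"
    by (intro bounded_clinear_adjoint_map \<Phi>)
  show ?thesis
  proof (intro exI[of _ "biadjoint_map \<Phi>"] conjI allI)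
    show "biadjoint_map \<Phi> ` multipliers \<subseteq> multipliers"
      using biadjoint_multipliers[OF \<Phi> mult assms(3)] by blast
    show "jordan_hom_on multipliers bidual_prod bidual_prod (biadjoint_map \<Phi>)"
      by (simp add: jordan_hom_on_def bounded_clinear_add[OF \<Psi>] bounded_clinear_scaleC[OF \<Psi>]
          biadjoint_bidual_prod[OF \<Phi> mult])
    show "biadjoint_map \<Phi> (canon a) = canon (\<Phi> a)" for a
      by (rule biadjoint_map_canon[OF \<Phi>])
    show "continuous_map J_strict_topology J_strict_topology (biadjoint_map \<Phi>)"
      by (rule continuous_map_J_strict_biadjoint[OF \<Phi> mult assms(3)])
  qed
qed

end
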